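(* For every real number $q$ with $1\leq q<\infty$ and $q\neq 2$, the averaging projection $\mathcal{P}$ onto Helson matrices, $$\mathcal{P}\colon (a_{m,n})_{m,n\geq1}\mapsto (\varrho_{mn})_{m,n\geq1},\qquad \varrho_k=\frac{1}{d(k)}\sum_{mn=k}a_{m,n}\quad(k\geq1),$$ where $d(k)$ denotes the number of divisors of $k$, is unbounded on the Schatten class $\mathcal{S}_q$.
   Context: $\mathbb{N}=\{1,2,3,\dots\}$. Infinite complex matrices $(a_{m,n})_{m,n\geq 1}$ are regarded as linear operators on $\ell^2(\mathbb{N})$ with respect to the standard orthonormal basis. A compact operator $A$ on $\ell^2(\mathbb{N})$ belongs to the Schatten class $\mathcal{S}_q$ if its sequence of singular values $s(A)=(s_k(A))_{k\geq 0}$ is in $\ell^q$, and then $\|A\|_{\mathcal{S}_q}=\|s(A)\|_{\ell^q}$. A Helson matrix is an infinite matrix of the form $(\varrho_{mn})_{m,n\geq1}$ for some sequence of complex numbers $(\varrho_k)_{k\geq1}$. The sum $\sum_{mn=k}$ runs over all pairs $(m,n)\in\mathbb{N}\times\mathbb{N}$ with $mn=k$. A linear map $\mathcal{P}$ on infinite matrices is bounded on $\mathcal{S}_q$ if there is a constant $C<\infty$ such that for every $A\in\mathcal{S}_q$ the matrix $\mathcal{P}A$ defines an operator in $\mathcal{S}_q$ with $\|\mathcal{P}A\|_{\mathcal{S}_q}\leq C\|A\|_{\mathcal{S}_q}$; it is unbounded on $\mathcal{S}_q$ if there is no such constant. *)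

theory Defs
  imports "HOL-Analysis.Analysis"
begin


text \<open>
  Sequences are indexed by the positive integers. They are represented by functions on
  \<^typ>\<open>nat\<close> which vanish at the unused index \<open>0\<close>.
\<close>

typedef ell2 = "{x :: nat \<Rightarrow> complex. x 0 = 0 \<and> summable (\<lambda>n. (cmod (x n))\<^sup>2)}"
  morphisms coord Abs_ell2
  by (rule exI[of _ "\<lambda>_. 0"]) simp

setup_lifting type_definition_ell2

lemma coord_0_index [simp]: "coord x 0 = 0"
  using coord[of x] by simp

lemma summable_coord: "summable (\<lambda>n. (cmod (coord x n))\<^sup>2)"
  using coord[of x] by simp

lemma ell2_eqI: "(\<And>n. coord x n = coord y n) \<Longrightarrow> x = y"
  by (simp add: coord_inject[symmetric] fun_eq_iff)

lemma summable_square_add: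
  fixes f g :: "nat \<Rightarrow> complex"
  assumes "summable (\<lambda>n. (cmod (f n))\<^sup>2)" "summable (\<lambda>n. (cmod (g n))\<^sup>2)"
  shows "summable (\<lambda>n. (cmod (f n + g n))\<^sup>2)"
proof (rule summable_comparison_test')
  show "summable (\<lambda>n. 2 * (cmod (f n))\<^sup>2 + 2 * (cmod (g n))\<^sup>2)"
    using assms by (intro summable_add summable_mult)
  fix n :: nat
  have "(cmod (f n + g n))\<^sup>2 \<le> (cmod (f n) + cmod (g n))\<^sup>2"
    by (intro power_mono norm_triangle_ineq) auto
  also have "\<dots> \<le> 2 * (cmod (f n))\<^sup>2 + 2 * (cmod (g n))\<^sup>2"
    using sum_squares_bound[of "cmod (f n)" "cmod (g n)"] by (simp add: power2_sum)
  finally show "norm ((cmod (f n + g n))\<^sup>2) \<le> 2 * (cmod (f n))\<^sup>2 + 2 * (cmod (g n))\<^sup>2"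
    by simp
qed

lemma summable_square_mult:
  "summable (\<lambda>n. (cmod (f n))\<^sup>2) \<Longrightarrow> summable (\<lambda>n. (cmod (c * f n))\<^sup>2)"
  by (simp add: norm_mult power_mult_distrib summable_mult)

lift_definition scaleC :: "complex \<Rightarrow> ell2 \<Rightarrow> ell2" is "\<lambda>c x n. c * x n"
  by (simp add: summable_square_mult)

definition cinner :: "ell2 \<Rightarrow> ell2 \<Rightarrow> complex" where
  "cinner x y = (\<Sum>n. coord x n * cnj (coord y n))"

lemma summable_cinner: "summable (\<lambda>n. coord x n * cnj (coord y n))"
proof (rule summable_comparison_test')
  show "summable (\<lambda>n. (cmod (coord x n))\<^sup>2 + (cmod (coord y n))\<^sup>2)"
    by (intro summable_add summable_coord)
  fix n :: nat
  show "norm (coord x n * cnj (coord y n)) \<le> (cmod (coord x n))\<^sup>2 + (cmod (coord y n))\<^sup>2"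
    using sum_squares_bound[of "cmod (coord x n)" "cmod (coord y n)"]
      mult_nonneg_nonneg[OF norm_ge_zero[of "coord x n"] norm_ge_zero[of "coord y n"]]
    unfolding norm_mult complex_mod_cnj by linarith
qed

instantiation ell2 :: real_inner
begin

lift_definition zero_ell2 :: ell2 is "\<lambda>_. 0"
  by simp

lift_definition plus_ell2 :: "ell2 \<Rightarrow> ell2 \<Rightarrow> ell2" is "\<lambda>x y n. x n + y n"
  by (simp add: summable_square_add)

lift_definition uminus_ell2 :: "ell2 \<Rightarrow> ell2" is "\<lambda>x n. - x n"
  by simp

definition minus_ell2 :: "ell2 \<Rightarrow> ell2 \<Rightarrow> ell2" where
  "minus_ell2 x y = x + - y"

definition scaleR_ell2 :: "real \<Rightarrow> ell2 \<Rightarrow> ell2" where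
  "scaleR_ell2 r x = scaleC (complex_of_real r) x"

definition inner_ell2 :: "ell2 \<Rightarrow> ell2 \<Rightarrow> real" where
  "inner_ell2 x y = Re (cinner x y)"

definition norm_ell2 :: "ell2 \<Rightarrow> real" where
  "norm_ell2 x = sqrt (inner x x)"

definition dist_ell2 :: "ell2 \<Rightarrow> ell2 \<Rightarrow> real" where
  "dist_ell2 x y = norm (x - y)"

definition sgn_ell2 :: "ell2 \<Rightarrow> ell2" where
  "sgn_ell2 x = scaleR (inverse (norm x)) x"

definition uniformity_ell2 :: "(ell2 \<times> ell2) filter" where
  "uniformity_ell2 = (INF e\<in>{0<..}. principal {(x, y). dist x y < e})"

definition open_ell2 :: "ell2 set \<Rightarrow> bool" where
  "open_ell2 U = (\<forall>x\<in>U. eventually (\<lambda>(x', y). x' = x \<longrightarrow> y \<in> U) uniformity)"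

instance
proof
  fix x y z :: ell2 and a b r :: real and U :: "ell2 set"
  show "x + y + z = x + (y + z)" "x + y = y + x" "0 + x = x" "- x + x = 0"
    by (transfer; simp add: fun_eq_iff)+
  show "x - y = x + - y"
    by (simp add: minus_ell2_def)
  show "a *\<^sub>R (x + y) = a *\<^sub>R x + a *\<^sub>R y" "(a + b) *\<^sub>R x = a *\<^sub>R x + b *\<^sub>R x"
    "a *\<^sub>R b *\<^sub>R x = (a * b) *\<^sub>R x" "1 *\<^sub>R x = x"
    unfolding scaleR_ell2_def by (transfer; simp add: fun_eq_iff algebra_simps)+
  show "dist x y = norm (x - y)" by (fact dist_ell2_def)
  show "sgn x = inverse (norm x) *\<^sub>R x" by (fact sgn_ell2_def)
  show "uniformity = (INF e\<in>{0<..}. principal {(x, y :: ell2). dist x y < e})"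
    by (fact uniformity_ell2_def)
  show "open U \<longleftrightarrow> (\<forall>x\<in>U. eventually (\<lambda>(x', y). x' = x \<longrightarrow> y \<in> U) uniformity)"
    by (fact open_ell2_def)
  show "norm x = sqrt (inner x x)" by (fact norm_ell2_def)
  have Re: "inner x y = (\<Sum>n. Re (coord x n * cnj (coord y n)))" for x y
    unfolding inner_ell2_def cinner_def by (rule bounded_linear.suminf[OF bounded_linear_Re summable_cinner])
  have sR: "summable (\<lambda>n. Re (coord x n * cnj (coord y n)))" for x y
    by (rule bounded_linear.summable[OF bounded_linear_Re summable_cinner])
  show "inner x y = inner y x"
    unfolding Re by (simp add: mult.commute)
  show "inner (x + y) z = inner x z + inner y z"
    unfolding Re by (subst suminf_add[OF sR sR]) (simp add: plus_ell2.rep_eq algebra_simps)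
  show "inner (r *\<^sub>R x) y = r * inner x y"
    unfolding Re by (subst suminf_mult[OF sR, symmetric])
      (simp add: scaleR_ell2_def scaleC.rep_eq algebra_simps)
  have sq: "inner x x = (\<Sum>n. (cmod (coord x n))\<^sup>2)"
    unfolding Re by (simp add: cmod_power2) (simp add: power2_eq_square)
  show "0 \<le> inner x x"
    unfolding sq by (intro suminf_nonneg summable_coord) auto
  show "inner x x = 0 \<longleftrightarrow> x = 0"
  proof
    assume "inner x x = 0"
    then have "\<forall>n. (cmod (coord x n))\<^sup>2 = 0"
      unfolding sq using suminf_eq_zero_iff[OF summable_coord[of x]] by simp
    then show "x = 0"
      by (intro ell2_eqI) (simp add: zero_ell2.rep_eq)
  next
    assume "x = 0"
    then show "inner x x = 0"
      unfolding sq by (simp add: zero_ell2.rep_eq)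
  qed
qed

end

global_interpretation ell2: vector_space scaleC
  by unfold_locales (transfer; simp add: fun_eq_iff algebra_simps)+

text \<open>The standard orthonormal basis vectors; \<open>unit_vec n\<close> is used for \<open>n \<ge> 1\<close> only.\<close>

lift_definition unit_vec :: "nat \<Rightarrow> ell2" is "\<lambda>n m. if m = n \<and> n \<ge> 1 then 1 else 0"
proof -
  fix n :: nat
  have "summable (\<lambda>m. (cmod (if m = n \<and> n \<ge> 1 then 1 else 0))\<^sup>2)"
    by (rule summable_finite[of "{n}"]) auto
  then show "(if 0 = n \<and> n \<ge> 1 then 1 else 0 :: complex) = 0 \<and>
      summable (\<lambda>m. (cmod (if m = n \<and> n \<ge> 1 then 1 else 0))\<^sup>2)"
    by auto
qed



definition compact_operator :: "(ell2 \<Rightarrow> ell2) \<Rightarrow> bool" where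
  "compact_operator T \<longleftrightarrow>
     Vector_Spaces.linear scaleC scaleC T \<and> compact (closure (T ` ball 0 1))"

text \<open>For bounded complex linear \<open>T\<close> the adjoint exists and is unique.\<close>

definition cadjoint :: "(ell2 \<Rightarrow> ell2) \<Rightarrow> ell2 \<Rightarrow> ell2" where
  "cadjoint T = (SOME S. \<forall>x y. cinner (T x) y = cinner x (S y))"

text \<open>
  The singular values are the square roots of the eigenvalues of \<open>T\<^sup>* T\<close>, listed in
  nonincreasing order and repeated according to (complex) multiplicity; if there are only
  finitely many positive ones, the list is continued by zeros. If there are infinitely many
  positive ones, the value zero does not occur. Since \<open>dim\<close> is \<open>0\<close> for infinite dimensional
  spaces, this is meaningful for compact \<open>T\<close>, where all eigenspaces in question are finite
  dimensional.
\<close>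

definition is_singular_value_seq :: "(ell2 \<Rightarrow> ell2) \<Rightarrow> (nat \<Rightarrow> real) \<Rightarrow> bool" where
  "is_singular_value_seq T s \<longleftrightarrow>
     decseq s \<and> (\<forall>k. s k \<ge> 0) \<and>
     (\<forall>\<sigma>>0. finite {k. s k = \<sigma>} \<and>
        card {k. s k = \<sigma>} =
          ell2.dim {x. cadjoint T (T x) = scaleC (complex_of_real (\<sigma>\<^sup>2)) x})"

definition singular_values :: "(ell2 \<Rightarrow> ell2) \<Rightarrow> nat \<Rightarrow> real" where
  "singular_values T = (THE s. is_singular_value_seq T s)"

lemma is_singular_value_seq_le:
  assumes s: "is_singular_value_seq T s" and t: "is_singular_value_seq T t"
    and eq: "\<And>j. j < k \<Longrightarrow> s j = t j"
  shows "s k \<le> t k"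
proof (rule ccontr)
  assume less: "\<not> s k \<le> t k"
  define \<sigma> where "\<sigma> = s k"
  have "\<sigma> > 0"
    using less t by (auto simp: \<sigma>_def is_singular_value_seq_def not_le intro: le_less_trans)
  then have fin: "finite {j. s j = \<sigma>}" and card: "card {j. t j = \<sigma>} = card {j. s j = \<sigma>}"
    using s t by (auto simp: is_singular_value_seq_def)
  have "t j < \<sigma>" if "j \<ge> k" for j
    using t less that by (auto simp: \<sigma>_def is_singular_value_seq_def dest: decseqD[of t k j])
  then have "j < k" if "t j = \<sigma>" for j
    using that by (meson less_irrefl not_le)
  then have "{j. t j = \<sigma>} \<subseteq> {j. s j = \<sigma>} - {k}"
    using eq by fastforce
  moreover have "k \<in> {j. s j = \<sigma>}"
    by (simp add: \<sigma>_def)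
  ultimately have "{j. t j = \<sigma>} \<subset> {j. s j = \<sigma>}"
    by blast
  then show False
    using psubset_card_mono[OF fin, of "{j. t j = \<sigma>}"] card by linarith
qed

lemma is_singular_value_seq_unique:
  assumes "is_singular_value_seq T s" "is_singular_value_seq T t"
  shows "s = t"
proof
  fix k show "s k = t k"
  proof (induction k rule: less_induct)
    case (less k)
    then show ?case
      using is_singular_value_seq_le[OF assms, of k] is_singular_value_seq_le[OF assms(2,1), of k]
      by (simp add: antisym)
  qed
qed

lemma singular_values_eqI: "is_singular_value_seq T s \<Longrightarrow> singular_values T = s"
  unfolding singular_values_def using is_singular_value_seq_unique by blast

definition schatten_class :: "real \<Rightarrow> (ell2 \<Rightarrow> ell2) set" where
  "schatten_class q = {T. compact_operator T \<and> summable (\<lambda>k. singular_values T k powr q)}"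

definition schatten_norm :: "real \<Rightarrow> (ell2 \<Rightarrow> ell2) \<Rightarrow> real" where
  "schatten_norm q T = (\<Sum>k. singular_values T k powr q) powr (1 / q)"



text \<open>
  As for sequences, index \<open>0\<close> is unused: only entries with both indices positive are meaningful.
  A compact (hence bounded) operator is determined by these entries of its matrix.
\<close>

type_synonym inf_matrix = "nat \<Rightarrow> nat \<Rightarrow> complex"

definition matrix_of_op :: "(ell2 \<Rightarrow> ell2) \<Rightarrow> inf_matrix" where
  "matrix_of_op T m n = cinner (T (unit_vec n)) (unit_vec m)"

definition defines_op :: "inf_matrix \<Rightarrow> (ell2 \<Rightarrow> ell2) \<Rightarrow> bool" where
  "defines_op a T \<longleftrightarrow> (\<forall>m\<ge>1. \<forall>n\<ge>1. matrix_of_op T m n = a m n)"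

definition bounded_on_schatten :: "real \<Rightarrow> (inf_matrix \<Rightarrow> inf_matrix) \<Rightarrow> bool" where
  "bounded_on_schatten q P \<longleftrightarrow>
     (\<exists>C. \<forall>A\<in>schatten_class q. \<exists>B\<in>schatten_class q.
        defines_op (P (matrix_of_op A)) B \<and> schatten_norm q B \<le> C * schatten_norm q A)"

definition is_helson_matrix :: "inf_matrix \<Rightarrow> bool" where
  "is_helson_matrix a \<longleftrightarrow> (\<exists>\<rho>. \<forall>m\<ge>1. \<forall>n\<ge>1. a m n = \<rho> (m * n))"

definition divisor_average :: "inf_matrix \<Rightarrow> nat \<Rightarrow> complex" where
  "divisor_average a k =
     (\<Sum>(m, n) \<in> {(m, n). m \<ge> 1 \<and> n \<ge> 1 \<and> m * n = k}. a m n) / of_nat (card {d. d dvd k})"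

definition helson_averaging :: "inf_matrix \<Rightarrow> inf_matrix" where
  "helson_averaging a = (\<lambda>m n. divisor_average a (m * n))"

lemma is_helson_matrix_averaging: "is_helson_matrix (helson_averaging a)"
  unfolding is_helson_matrix_def helson_averaging_def by blast

lemma helson_averaging_fixes_helson:
  assumes "is_helson_matrix a" "m \<ge> 1" "n \<ge> 1"
  shows "helson_averaging a m n = a m n"
proof -
  obtain \<rho> where \<rho>: "\<And>m n. m \<ge> 1 \<Longrightarrow> n \<ge> 1 \<Longrightarrow> a m n = \<rho> (m * n)"
    using assms(1) by (auto simp: is_helson_matrix_def)
  define k where "k = m * n"
  have k: "k > 0" using assms by (simp add: k_def)
  let ?S = "{(m, n). m \<ge> 1 \<and> n \<ge> 1 \<and> m * n = k}"
  have "bij_betw fst ?S {d. d dvd k}"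
    unfolding bij_betw_def
  proof
    show "inj_on fst ?S"
      using k by (auto simp: inj_on_def)
    have "d \<in> fst ` ?S" if "d dvd k" for d
    proof -
      obtain c where "k = d * c" using \<open>d dvd k\<close> by (rule dvdE)
      with k have "(d, c) \<in> ?S" by simp
      then show ?thesis by force
    qed
    then show "fst ` ?S = {d. d dvd k}"
      by fastforce
  qed
  then have card: "card ?S = card {d. d dvd k}"
    by (rule bij_betw_same_card)
  have "(\<Sum>(m, n)\<in>?S. a m n) = (\<Sum>_\<in>?S. \<rho> k)"
    by (rule sum.cong) (auto simp: \<rho>)
  also have "\<dots> = of_nat (card {d. d dvd k}) * \<rho> k"
    by (simp only: sum_constant card)
  finally have sum: "(\<Sum>(m, n)\<in>?S. a m n) = of_nat (card {d. d dvd k}) * \<rho> k" .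
  have "card {d. d dvd k} \<noteq> 0"
    using k by (auto simp: card_eq_0_iff finite_divisors_nat)
  then show ?thesis
    using sum \<rho>[OF assms(2,3)]
    by (simp add: helson_averaging_def divisor_average_def flip: k_def)
qed

end

theory Submission imports Defs begin

text \<open>
  Unique factorisation turns Helson matrices into tensor products. Write \<open>m\<close> and \<open>n\<close> through their
  exponent vectors. The divisor pairs of a product of coprime numbers are the products of their
  divisor pairs, so the averaging projection is the tensor product, over all primes, of one and the
  same projection \<open>Q\<close>: the averaging of a matrix indexed by \<open>0, 1, 2, \<dots>\<close> along its
  antidiagonals \<open>j + k = const\<close>, which maps onto Hankel matrices (\<open>helson_averaging_kron\<close>).

  Singular values multiply under tensor products. Hence, if a single matrix \<open>F\<close> satisfies
  \<open>\<parallel>Q F\<parallel> > \<parallel>F\<parallel>\<close> in the Schatten norm, then placing \<open>F\<close> on each of the first \<open>d\<close> primes gives matrices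
  whose norm is enlarged by the factor \<open>(\<parallel>Q F\<parallel> / \<parallel>F\<parallel>) ^ d\<close>, and no constant bounds these factors
  (\<open>unbounded_by_tensor_powers\<close>). So unboundedness in infinitely many variables comes from a norm
  above \<open>1\<close> in a single variable.

  Such \<open>F\<close> with at most \<open>3\<close> rows and columns exist for \<open>q \<noteq> 2\<close>. For \<open>t > 1\<close> and \<open>a = t - 1/t\<close> the
  Hankel matrix \<open>H\<close> with rows \<open>(a, 0, 1)\<close>, \<open>(0, 1, 0)\<close>, \<open>(1, 0, 0)\<close> has eigenvalues \<open>t, 1, -1/t\<close>, so that
  \<open>\<parallel>H\<parallel>\<^sup>q = t\<^sup>q + 1 + t\<^sup>-\<^sup>q\<close>. It is the average of every matrix with corner entry \<open>a\<close> whose other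
  entries lie on the antidiagonal \<open>j + k = 2\<close> and have sum \<open>3\<close>. For \<open>q < 2\<close> matrices of
  low rank have small norm relative to their Hilbert--Schmidt norm, and \<open>F\<close> is the rank one matrix with single row \<open>(a, 0, 3)\<close>; its norm is
  \<open>sqrt (a\<^sup>2 + 9)\<close>, with \<open>q\<close>-th power \<open>t\<^sup>q + O(t ^ (q - 2))\<close>, which for large \<open>t\<close> is below \<open>t\<^sup>q + 1\<close>.
  For \<open>q > 2\<close> the norm is governed by the largest singular value, and \<open>F\<close> is the diagonal matrix
  with entries \<open>a, 3\<close>; here \<open>a\<^sup>q + 3\<^sup>q\<close> falls below \<open>t\<^sup>q\<close>, because \<open>t\<^sup>q - a\<^sup>q\<close> grows like \<open>t ^ (q - 2)\<close>.

  All matrices that occur are finite and come with an explicit singular value decomposition, from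
  which the Schatten norm is read off (\<open>schatten_svd_op\<close>). Only one more fact about operators is
  needed: a compact operator is determined by its matrix (\<open>compact_operator_eqI\<close>), so the operator
  that boundedness provides for an averaged matrix is the one whose norm has been computed.
\<close>

section \<open>The inner product\<close>

lemma cinner_add_left: "cinner (x + y) z = cinner x z + cinner y z"
  unfolding cinner_def
  by (subst suminf_add[OF summable_cinner summable_cinner])
    (simp add: plus_ell2.rep_eq algebra_simps)

lemma cinner_scaleC_left: "cinner (scaleC c x) y = c * cinner x y"
  unfolding cinner_def
  by (subst suminf_mult[OF summable_cinner, symmetric]) (simp add: scaleC.rep_eq algebra_simps)

lemma cinner_commute: "cinner x y = cnj (cinner y x)"
  unfolding cinner_def
  by (subst bounded_linear.suminf[OF bounded_linear_cnj summable_cinner])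
    (simp add: mult.commute)

lemma cinner_zero_left [simp]: "cinner 0 y = 0"
  by (simp add: cinner_def zero_ell2.rep_eq)

lemma cinner_sum_left: "cinner (sum f I) y = (\<Sum>i\<in>I. cinner (f i) y)"
  by (induction I rule: infinite_finite_induct) (auto simp: cinner_add_left)

lemma cinner_scaleC_right: "cinner x (scaleC c y) = cnj c * cinner x y"
  by (metis cinner_commute cinner_scaleC_left complex_cnj_mult complex_cnj_cnj)

lemma cinner_sum_right: "cinner x (sum f I) = (\<Sum>i\<in>I. cinner x (f i))"
  by (subst cinner_commute, subst cinner_sum_left)
    (simp, intro sum.cong, auto simp: cinner_commute[of x])

lemma cinner_unit_vec_right: "cinner x (unit_vec n) = coord x n"
proof -
  have "cinner x (unit_vec n) = (\<Sum>m\<in>{n}. coord x m * cnj (coord (unit_vec n) m))"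
    unfolding cinner_def by (rule suminf_finite) (auto simp: unit_vec.rep_eq)
  then show ?thesis
    by (cases "n \<ge> 1") (auto simp: unit_vec.rep_eq not_le)
qed

lemma cinner_self: "cinner x x = complex_of_real ((norm x)\<^sup>2)"
proof (rule complex_eqI)
  show "Re (cinner x x) = Re (complex_of_real ((norm x)\<^sup>2))"
    by (simp add: power2_norm_eq_inner inner_ell2_def)
  have "cinner x x = cnj (cinner x x)" by (rule cinner_commute)
  then show "Im (cinner x x) = Im (complex_of_real ((norm x)\<^sup>2))"
    by (simp add: complex_eq_iff)
qed

lemma norm_square_ell2: "(norm x)\<^sup>2 = (\<Sum>n. (cmod (coord x n))\<^sup>2)"
proof -
  have "complex_of_real (\<Sum>n. (cmod (coord x n))\<^sup>2) = cinner x x"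
    unfolding cinner_def complex_norm_square[symmetric] of_real_power[symmetric]
    by (rule bounded_linear.suminf[OF bounded_linear_of_real summable_coord])
  then show ?thesis
    unfolding cinner_self of_real_eq_iff by simp
qed

lemma norm_scaleC: "norm (scaleC c x) = cmod c * norm x"
proof -
  have "complex_of_real ((norm (scaleC c x))\<^sup>2) = complex_of_real ((cmod c * norm x)\<^sup>2)"
    unfolding cinner_self[symmetric] power_mult_distrib of_real_mult
    by (simp add: cinner_scaleC_left cinner_scaleC_right mult_ac) (simp add: complex_norm_square[symmetric] mult.left_commute)
  then have "(norm (scaleC c x))\<^sup>2 = (cmod c * norm x)\<^sup>2"
    unfolding of_real_eq_iff .
  then show ?thesis
    by (simp add: power2_eq_iff_nonneg)
qed

text \<open>
  The Cauchy--Schwarz inequality of the underlying real inner product bounds only the real part of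
  \<^term>\<open>cinner x y\<close>; multiplying \<open>x\<close> by a suitable phase makes this inner product real.
\<close>

lemma cmod_cinner_le: "cmod (cinner x y) \<le> norm x * norm y"
proof (cases "cinner x y = 0")
  case False
  define c where "c = cnj (sgn (cinner x y))"
  have c: "cmod c = 1"
    using False by (simp add: c_def norm_sgn)
  have "cinner (scaleC c x) y = complex_of_real (cmod (cinner x y))"
    using False complex_norm_square[of "cinner x y"]
    by (simp add: cinner_scaleC_left c_def sgn_eq field_simps power2_eq_square)
  then have "cmod (cinner x y) = inner (scaleC c x) y"
    by (simp add: inner_ell2_def)
  also have "\<dots> \<le> norm (scaleC c x) * norm y"
    by (rule norm_cauchy_schwarz)
  finally show ?thesis
    by (simp add: norm_scaleC c)
qed simp

lemma scaleR_eq_scaleC: "r *\<^sub>R x = scaleC (complex_of_real r) x"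
  by (rule scaleR_ell2_def)

section \<open>A compact operator is determined by its matrix\<close>

lemma coord_sum: "coord (sum f I) n = (\<Sum>i\<in>I. coord (f i) n)"
  by (induction I rule: infinite_finite_induct) (auto simp: plus_ell2.rep_eq zero_ell2.rep_eq)

lemma coord_diff: "coord (x - y) n = coord x n - coord y n"
  unfolding minus_ell2_def plus_ell2.rep_eq uminus_ell2.rep_eq by simp

text \<open>
  The squared distance of \<open>x\<close> to its \<open>k\<close>-th truncation is the tail of a convergent series.
\<close>

lemma truncation_tendsto:
  "(\<lambda>k. \<Sum>n<k. scaleC (coord x n) (unit_vec n)) \<longlonglongrightarrow> x"
proof -
  define f where "f n = (cmod (coord x n))\<^sup>2" for n
  define y where "y k = (\<Sum>n<k. scaleC (coord x n) (unit_vec n))" for k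
  have f: "summable f"
    unfolding f_def by (rule summable_coord)
  have "coord (y k) m = (if m < k then coord x m else 0)" for k m
  proof -
    have "coord (y k) m = (\<Sum>n<k. if n = m then coord x m else 0)"
      unfolding y_def coord_sum
      by (rule sum.cong) (auto simp: scaleC.rep_eq unit_vec.rep_eq not_le)
    then show ?thesis by simp
  qed
  then have *: "(cmod (coord (y k - x) m))\<^sup>2 = f m - (if m \<in> {..<k} then f m else 0)" for k m
    by (simp add: coord_diff f_def)
  have "(norm (y k - x))\<^sup>2 = suminf f - sum f {..<k}" for k
  proof -
    have "(norm (y k - x))\<^sup>2 = (\<Sum>m. f m - (if m \<in> {..<k} then f m else 0))"
      unfolding norm_square_ell2 * ..
    also have "\<dots> = suminf f - (\<Sum>m. if m \<in> {..<k} then f m else 0)"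
      by (rule suminf_diff[symmetric, OF f])
        (rule summable_finite[of "{..<k}"], auto)
    also have "(\<Sum>m. if m \<in> {..<k} then f m else 0) = sum f {..<k}"
      by (subst suminf_finite[of "{..<k}"]) auto
    finally show ?thesis .
  qed
  moreover have "(\<lambda>k. suminf f - sum f {..<k}) \<longlonglongrightarrow> suminf f - suminf f"
    by (intro tendsto_intros summable_LIMSEQ f)
  ultimately have "(\<lambda>k. (norm (y k - x))\<^sup>2) \<longlonglongrightarrow> 0"
    by simp
  then have "(\<lambda>k. sqrt ((norm (y k - x))\<^sup>2)) \<longlonglongrightarrow> sqrt 0"
    by (rule tendsto_real_sqrt)
  then have "y \<longlonglongrightarrow> x"
    by (simp add: tendsto_norm_zero_iff LIM_zero_iff)
  then show ?thesis
    unfolding y_def .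
qed

lemma compact_operator_bounded_linear:
  assumes "compact_operator T"
  shows "bounded_linear T"
proof -
  interpret Vector_Spaces.linear scaleC scaleC T
    using assms by (simp add: compact_operator_def)
  have "bounded (closure (T ` ball 0 1))"
    using assms by (auto simp: compact_operator_def intro: compact_imp_bounded)
  then obtain K where K: "\<And>x. norm x < 1 \<Longrightarrow> norm (T x) \<le> K"
    unfolding bounded_iff using closure_subset[of "T ` ball 0 1"] by fastforce
  show ?thesis
  proof (rule bounded_linear_intro)
    show "T (x + y) = T x + T y" for x y
      by (rule add)
    show "T (r *\<^sub>R x) = r *\<^sub>R T x" for r x
      by (simp add: scaleR_eq_scaleC scale)
    show "norm (T x) \<le> norm x * (2 * K)" for x
    proof (cases "x = 0")
      case True
      have "T 0 = 0" by (rule zero)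
      then show ?thesis using True by simp
    next
      case False
      define y where "y = scaleC (complex_of_real (1 / (2 * norm x))) x"
      have "norm y < 1"
        using False by (simp add: y_def norm_scaleC norm_divide norm_mult)
      then have "norm (T y) \<le> K"
        by (rule K)
      moreover have "norm (T y) = norm (T x) / (2 * norm x)"
        using False by (simp add: y_def scale norm_scaleC norm_divide norm_mult)
      ultimately show ?thesis
        using False by (simp add: field_simps)
    qed
  qed
qed

text \<open>
  Both operators are continuous and agree on the unit vectors, hence on all truncations of a
  vector, which converge to it.
\<close>

lemma compact_operator_eqI:
  assumes S: "compact_operator S" and T: "compact_operator T"
    and eq: "\<And>m n. m \<ge> 1 \<Longrightarrow> n \<ge> 1 \<Longrightarrow> matrix_of_op S m n = matrix_of_op T m n"
  shows "S = T"
proof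
  fix x
  interpret S: Vector_Spaces.linear scaleC scaleC S
    using S by (simp add: compact_operator_def)
  interpret T: Vector_Spaces.linear scaleC scaleC T
    using T by (simp add: compact_operator_def)
  have unit: "S (unit_vec n) = T (unit_vec n)" for n
  proof (cases "n \<ge> 1")
    case True
    show ?thesis
    proof (rule ell2_eqI)
      fix m show "coord (S (unit_vec n)) m = coord (T (unit_vec n)) m"
        using eq[of m n] True
        by (cases "m \<ge> 1") (auto simp: matrix_of_op_def cinner_unit_vec_right not_le)
    qed
  next
    case False
    then have "unit_vec n = 0"
      by (intro ell2_eqI) (simp add: unit_vec.rep_eq zero_ell2.rep_eq)
    then show ?thesis by (simp only: S.zero T.zero)
  qed
  let ?y = "\<lambda>k. \<Sum>n<k. scaleC (coord x n) (unit_vec n)"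
  have "S (?y k) = T (?y k)" for k
    by (simp add: S.sum T.sum S.scale T.scale unit)
  moreover have "(\<lambda>k. S (?y k)) \<longlonglongrightarrow> S x"
    by (rule bounded_linear.tendsto[OF compact_operator_bounded_linear[OF S] truncation_tendsto])
  moreover have "(\<lambda>k. T (?y k)) \<longlonglongrightarrow> T x"
    by (rule bounded_linear.tendsto[OF compact_operator_bounded_linear[OF T] truncation_tendsto])
  ultimately show "S x = T x"
    by (simp add: LIMSEQ_unique)
qed

section \<open>Operators given by a finite singular value decomposition\<close>

definition orthonormal :: "'i set \<Rightarrow> ('i \<Rightarrow> ell2) \<Rightarrow> bool" where
  "orthonormal I u \<longleftrightarrow> (\<forall>i\<in>I. \<forall>j\<in>I. cinner (u i) (u j) = (if i = j then 1 else 0))"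

definition svd_op :: "'i set \<Rightarrow> ('i \<Rightarrow> real) \<Rightarrow> ('i \<Rightarrow> ell2) \<Rightarrow> ('i \<Rightarrow> ell2) \<Rightarrow> ell2 \<Rightarrow> ell2" where
  "svd_op I s u v x = (\<Sum>i\<in>I. scaleC (complex_of_real (s i) * cinner x (v i)) (u i))"

lemma linear_svd_op: "Vector_Spaces.linear scaleC scaleC (svd_op I s u v)"
proof unfold_locales
  fix x y c
  show "svd_op I s u v (x + y) = svd_op I s u v x + svd_op I s u v y"
    by (simp add: svd_op_def cinner_add_left distrib_left ell2.scale_left_distrib sum.distrib)
  show "svd_op I s u v (scaleC c x) = scaleC c (svd_op I s u v x)"
    by (simp add: svd_op_def cinner_scaleC_left ell2.scale_sum_right mult_ac)
qed

text \<open>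
  This set is a finite Minkowski sum of images of discs. It replaces the statement that bounded sets
  in finite dimensional spaces are relatively compact, and makes finite rank operators compact.
\<close>

lemma compact_coefficient_box:
  assumes "finite I"
  shows "compact {\<Sum>i\<in>I. scaleC (c i) (u i) |c. \<forall>i\<in>I. cmod (c i) \<le> R}"
  using assms
proof (induction I)
  case empty
  have "{\<Sum>i\<in>{}. scaleC (c i) (u i) |c. \<forall>i\<in>{}. cmod (c i) \<le> R} = {0}"
    by auto
  then show ?case by simp
next
  case (insert j I)
  let ?K = "{\<Sum>i\<in>I. scaleC (c i) (u i) |c. \<forall>i\<in>I. cmod (c i) \<le> R}"
  let ?L = "(\<lambda>z. scaleC z (u j)) ` cball 0 R"
  have "bounded_linear (\<lambda>z. scaleC z (u j))"
    by (rule bounded_linear_intro[of _ "norm (u j)"])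
      (simp_all add: ell2.scale_left_distrib scaleR_eq_scaleC norm_scaleC scaleR_conv_of_real)
  then have "compact ?L"
    by (intro compact_continuous_image linear_continuous_on compact_cball)
  then have "compact {x + y |x y. x \<in> ?L \<and> y \<in> ?K}"
    using insert.IH by (rule compact_sums)
  also have "{x + y |x y. x \<in> ?L \<and> y \<in> ?K} =
      {\<Sum>i\<in>insert j I. scaleC (c i) (u i) |c. \<forall>i\<in>insert j I. cmod (c i) \<le> R}" (is "?A = ?B")
  proof
    show "?A \<subseteq> ?B"
    proof
      fix w assume "w \<in> ?A"
      then obtain z c where w: "w = scaleC z (u j) + (\<Sum>i\<in>I. scaleC (c i) (u i))"
        and z: "cmod z \<le> R" and c: "\<forall>i\<in>I. cmod (c i) \<le> R"
        by auto
      have "w = (\<Sum>i\<in>insert j I. scaleC ((c(j := z)) i) (u i))"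
        using insert.hyps unfolding w by (auto simp: intro!: sum.cong)
      then show "w \<in> ?B"
        using z c by (intro CollectI exI[of _ "c(j := z)"]) auto
    qed
    show "?B \<subseteq> ?A"
      using insert.hyps by fastforce
  qed
  finally show ?case .
qed

lemma compact_operator_svd_op:
  assumes "finite I"
  shows "compact_operator (svd_op I s u v)"
proof -
  define R where "R = (\<Sum>i\<in>I. \<bar>s i\<bar> * norm (v i))"
  let ?K = "{\<Sum>i\<in>I. scaleC (c i) (u i) |c. \<forall>i\<in>I. cmod (c i) \<le> R}"
  have K: "compact ?K"
    using assms by (rule compact_coefficient_box)
  have "svd_op I s u v x \<in> ?K" if x: "norm x < 1" for x
  proof -
    have "cmod (complex_of_real (s i) * cinner x (v i)) \<le> R" if "i \<in> I" for i
    proof -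
      have "cmod (cinner x (v i)) \<le> 1 * norm (v i)"
        using cmod_cinner_le[of x "v i"] x
        by (meson less_imp_le mult_right_mono norm_ge_zero order_trans)
      then have "cmod (complex_of_real (s i) * cinner x (v i)) \<le> \<bar>s i\<bar> * norm (v i)"
        by (simp add: norm_mult mult_left_mono)
      also have "\<dots> \<le> R"
        unfolding R_def by (rule member_le_sum) (use assms \<open>i \<in> I\<close> in auto)
      finally show ?thesis .
    qed
    then show ?thesis
      unfolding svd_op_def by auto
  qed
  then have "closure (svd_op I s u v ` ball 0 1) \<subseteq> ?K"
    using K by (intro closure_minimal compact_imp_closed) auto
  then have "?K \<inter> closure (svd_op I s u v ` ball 0 1) = closure (svd_op I s u v ` ball 0 1)"
    by blast
  then have "compact (closure (svd_op I s u v ` ball 0 1))"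
    using compact_Int_closed[OF K, of "closure (svd_op I s u v ` ball 0 1)"] by simp
  then show ?thesis
    by (simp add: compact_operator_def linear_svd_op)
qed

lemma cadjoint_svd_op: "cadjoint (svd_op I s u v) = svd_op I s v u"
proof -
  have adj: "cinner (svd_op I s u v x) y = cinner x (svd_op I s v u y)" for x y
    by (simp add: svd_op_def cinner_sum_left cinner_sum_right cinner_scaleC_left
        cinner_scaleC_right mult_ac)
      (intro sum.cong refl, simp add: cinner_commute[of _ y])
  have "cadjoint (svd_op I s u v) y = svd_op I s v u y" for y
  proof (rule ell2_eqI)
    fix n
    have "\<forall>x y. cinner (svd_op I s u v x) y = cinner x (cadjoint (svd_op I s u v) y)"
      using someI_ex[of "\<lambda>S. \<forall>x y. cinner (svd_op I s u v x) y = cinner x (S y)"] adj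
      unfolding cadjoint_def by blast
    then have "cinner (unit_vec n) (cadjoint (svd_op I s u v) y) =
        cinner (unit_vec n) (svd_op I s v u y)"
      by (simp add: adj[symmetric])
    then show "coord (cadjoint (svd_op I s u v) y) n = coord (svd_op I s v u y) n"
      unfolding cinner_commute[of "unit_vec n"] cinner_unit_vec_right complex_cnj_cancel_iff .
  qed
  then show ?thesis by blast
qed

lemma cinner_orthonormal_sum:
  assumes "finite I" "orthonormal I u" "j \<in> I"
  shows "cinner (\<Sum>i\<in>I. scaleC (c i) (u i)) (u j) = c j"
proof -
  have "cinner (\<Sum>i\<in>I. scaleC (c i) (u i)) (u j) = (\<Sum>i\<in>I. if i = j then c j else 0)"
    unfolding cinner_sum_left
    by (rule sum.cong) (use assms in \<open>auto simp: orthonormal_def cinner_scaleC_left\<close>)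
  then show ?thesis
    using assms by simp
qed

text \<open>
  The operator \<open>T\<^sup>* T\<close> acts as \<open>s\<^sub>i\<^sup>2\<close> on \<open>v\<^sub>i\<close> and as zero on the orthogonal complement of these vectors.
  As \<open>\<sigma> > 0\<close>, the complement does not contribute, and the eigenspace of \<open>\<sigma>\<^sup>2\<close> is spanned by the \<open>v\<^sub>i\<close>
  with \<open>s\<^sub>i = \<sigma>\<close>.
\<close>

lemma dim_singular_space:
  assumes I: "finite I" and u: "orthonormal I u" and v: "orthonormal I v"
    and \<sigma>: "\<sigma> > 0" and s: "\<And>i. i \<in> I \<Longrightarrow> s i > 0"
  shows "ell2.dim {x. cadjoint (svd_op I s u v) (svd_op I s u v x) =
            scaleC (complex_of_real (\<sigma>\<^sup>2)) x} = card {i \<in> I. s i = \<sigma>}"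
proof -
  let ?E = "{x. cadjoint (svd_op I s u v) (svd_op I s u v x) = scaleC (complex_of_real (\<sigma>\<^sup>2)) x}"
  let ?J = "{i \<in> I. s i = \<sigma>}"
  have square: "cadjoint (svd_op I s u v) (svd_op I s u v x) =
      (\<Sum>i\<in>I. scaleC (complex_of_real ((s i)\<^sup>2) * cinner x (v i)) (v i))" for x
    unfolding cadjoint_svd_op unfolding svd_op_def
    by (intro sum.cong refl)
      (simp add: cinner_orthonormal_sum[OF I u] power2_eq_square mult.assoc)
  have vJ: "orthonormal ?J v" and J: "finite ?J"
    using v I by (auto simp: orthonormal_def)
  have inj: "inj_on v ?J"
  proof (rule inj_onI, rule ccontr)
    fix i j assume "i \<in> ?J" "j \<in> ?J" and eq: "v i = v j" and "i \<noteq> j"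
    then have "cinner (v i) (v i) = (if i = i then 1 else 0)"
        "cinner (v i) (v j) = (if i = j then 1 else 0)"
      using vJ unfolding orthonormal_def by blast+
    then show False using eq \<open>i \<noteq> j\<close> by simp
  qed
  have indep: "ell2.independent (v ` ?J)"
  proof (rule ell2.independent_if_scalars_zero)
    show "finite (v ` ?J)" using J by simp
    fix f x assume zero: "(\<Sum>x\<in>v ` ?J. scaleC (f x) x) = 0" and "x \<in> v ` ?J"
    then obtain j where j: "j \<in> ?J" "x = v j" by auto
    have "f (v j) = cinner (\<Sum>i\<in>?J. scaleC (f (v i)) (v i)) (v j)"
      using cinner_orthonormal_sum[OF J vJ j(1)] by simp
    also have "(\<Sum>i\<in>?J. scaleC (f (v i)) (v i)) = 0"
      using zero by (simp add: sum.reindex[OF inj])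
    finally show "f x = 0" using j by simp
  qed
  interpret S: Vector_Spaces.linear scaleC scaleC "svd_op I s u v"
    by (rule linear_svd_op)
  interpret T: Vector_Spaces.linear scaleC scaleC "svd_op I s v u"
    by (rule linear_svd_op)
  have "ell2.subspace ?E"
    unfolding cadjoint_svd_op ell2.subspace_def
    by (simp add: S.zero S.add S.scale T.zero T.add T.scale ell2.scale_right_distrib mult.commute)
  moreover have "v ` ?J \<subseteq> ?E"
  proof clarify
    fix j assume j: "j \<in> I" "\<sigma> = s j"
    have "(\<Sum>i\<in>I. scaleC (complex_of_real ((s i)\<^sup>2) * cinner (v j) (v i)) (v i)) =
        (\<Sum>i\<in>I. if i = j then scaleC (complex_of_real ((s j)\<^sup>2)) (v j) else 0)"
      by (rule sum.cong) (use v j in \<open>auto simp: orthonormal_def\<close>)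
    then show "cadjoint (svd_op I s u v) (svd_op I s u v (v j)) =
        scaleC (complex_of_real ((s j)\<^sup>2)) (v j)"
      using I j unfolding square by simp
  qed
  ultimately have "ell2.span (v ` ?J) \<subseteq> ?E"
    by (intro ell2.span_minimal)
  moreover have "?E \<subseteq> ell2.span (v ` ?J)"
  proof clarify
    fix x assume "cadjoint (svd_op I s u v) (svd_op I s u v x) = scaleC (complex_of_real (\<sigma>\<^sup>2)) x"
    then have x: "(\<Sum>i\<in>I. scaleC (complex_of_real ((s i)\<^sup>2) * cinner x (v i)) (v i)) =
        scaleC (complex_of_real (\<sigma>\<^sup>2)) x" (is "?s = _")
      unfolding square .
    \<comment> \<open>Comparing coefficients at \<open>v\<^sub>j\<close> shows that an eigenvector only involves the \<open>v\<^sub>j\<close> with \<open>s\<^sub>j = \<sigma>\<close>.\<close>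
    have zero: "cinner x (v j) = 0" if "j \<in> I" "s j \<noteq> \<sigma>" for j
    proof -
      have "complex_of_real ((s j)\<^sup>2) * cinner x (v j) = complex_of_real (\<sigma>\<^sup>2) * cinner x (v j)"
        using arg_cong[OF x, of "\<lambda>w. cinner w (v j)"]
        by (simp add: cinner_orthonormal_sum[OF I v that(1)] cinner_scaleC_left)
      moreover have "(s j)\<^sup>2 \<noteq> \<sigma>\<^sup>2"
        using that \<sigma> s[of j] by (simp add: power2_eq_iff_nonneg)
      ultimately show ?thesis
        by (metis mult_right_cancel of_real_eq_iff)
    qed
    have "?s \<in> ell2.span (v ` ?J)"
    proof (rule ell2.span_sum)
      fix i assume "i \<in> I"
      then show "scaleC (complex_of_real ((s i)\<^sup>2) * cinner x (v i)) (v i) \<in> ell2.span (v ` ?J)"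
        using zero[of i]
        by (cases "s i = \<sigma>") (auto intro: ell2.span_scale ell2.span_base ell2.span_zero)
    qed
    then have "scaleC (complex_of_real (1 / \<sigma>\<^sup>2)) ?s \<in> ell2.span (v ` ?J)"
      by (rule ell2.span_scale)
    also have "scaleC (complex_of_real (1 / \<sigma>\<^sup>2)) ?s = x"
      using \<sigma> unfolding x by simp
    finally show "x \<in> ell2.span (v ` ?J)" .
  qed
  ultimately have "ell2.span (v ` ?J) = ?E"
    by blast
  then have "ell2.dim ?E = card (v ` ?J)"
    using ell2.dim_span_eq_card_independent[OF indep] ell2.dim_span[of "v ` ?J"]
    by simp
  then show ?thesis
    by (simp add: card_image[OF inj])
qed

text \<open>
  The positive weights \<open>s\<^sub>i\<close> of a decomposition come in no particular order. Sorted decreasingly and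
  continued by zeros, they form the sequence required of singular values; the zeros do not change
  the power sums, since \<^term>\<open>0 powr q = (0 :: real)\<close>.
\<close>

lemma decreasing_enumeration:
  fixes s :: "'i \<Rightarrow> real"
  assumes I: "finite I" and s: "\<And>i. i \<in> I \<Longrightarrow> s i > 0"
  obtains r where "decseq r" "\<And>k. r k \<ge> 0"
    "\<And>\<sigma>. \<sigma> > 0 \<Longrightarrow> finite {k. r k = \<sigma>} \<and> card {k. r k = \<sigma>} = card {i \<in> I. s i = \<sigma>}"
    "\<And>q. (\<lambda>k. r k powr q) sums (\<Sum>i\<in>I. s i powr q)"
proof -
  obtain il where il: "set il = I" "distinct il"
    using finite_distinct_list[OF I] by blast
  define xs where "xs = rev (sort (map s il))"
  define r where "r k = (if k < length xs then xs ! k else 0)" for k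
  have mset: "mset xs = mset (map s il)"
    by (simp add: xs_def)
  have pos: "x > 0" if "x \<in> set xs" for x
    using that s il by (auto simp: xs_def)
  have r_pos: "r k > 0" if "k < length xs" for k
    using that pos by (simp add: r_def)
  have nonneg: "r k \<ge> 0" for k
    using r_pos[of k] by (cases "k < length xs") (auto simp: r_def)
  have "sorted (rev xs)"
    by (simp add: xs_def)
  then have "decseq r"
    unfolding decseq_def
    by (auto simp: sorted_rev_iff_nth_mono r_def intro: less_imp_le[OF pos])
  moreover have "finite {k. r k = \<sigma>} \<and> card {k. r k = \<sigma>} = card {i \<in> I. s i = \<sigma>}"
    if "\<sigma> > 0" for \<sigma>
  proof -
    have eq: "{k. r k = \<sigma>} = {k. k < length xs \<and> xs ! k = \<sigma>}"
      using that by (auto simp: r_def split: if_splits)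
    have "card {k. r k = \<sigma>} = length (filter (\<lambda>x. x = \<sigma>) xs)"
      unfolding eq by (rule length_filter_conv_card[symmetric])
    also have "\<dots> = length (filter (\<lambda>x. x = \<sigma>) (map s il))"
      using mset by (metis mset_filter size_mset)
    also have "\<dots> = length (filter (\<lambda>i. s i = \<sigma>) il)"
      by (simp add: filter_map o_def)
    also have "\<dots> = card {i \<in> I. s i = \<sigma>}"
      using il by (metis distinct_card distinct_filter set_filter)
    finally show ?thesis
      unfolding eq by simp
  qed
  moreover have "(\<lambda>k. r k powr q) sums (\<Sum>i\<in>I. s i powr q)" for q
  proof -
    have "(\<lambda>k. r k powr q) sums (\<Sum>k<length xs. r k powr q)"
      by (rule sums_finite) (auto simp: r_def)
    also have "(\<Sum>k<length xs. r k powr q) = (\<Sum>x\<leftarrow>xs. x powr q)"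
      by (simp add: sum_list_sum_nth r_def atLeast0LessThan)
    also have "\<dots> = (\<Sum>x\<leftarrow>map s il. x powr q)"
      using mset by (metis mset_map sum_mset_sum_list)
    also have "\<dots> = (\<Sum>i\<in>I. s i powr q)"
      using il by (simp add: o_def sum_list_distinct_conv_sum_set)
    finally show ?thesis .
  qed
  ultimately show thesis
    using nonneg that by blast
qed

lemma schatten_svd_op:
  assumes I: "finite I" and u: "orthonormal I u" and v: "orthonormal I v"
    and s: "\<And>i. i \<in> I \<Longrightarrow> s i > 0"
  shows "svd_op I s u v \<in> schatten_class q"
    and "schatten_norm q (svd_op I s u v) = (\<Sum>i\<in>I. s i powr q) powr (1 / q)"
proof -
  obtain r where r: "decseq r" "\<And>k. r k \<ge> 0"
    "\<And>\<sigma>. \<sigma> > 0 \<Longrightarrow> finite {k. r k = \<sigma>} \<and> card {k. r k = \<sigma>} = card {i \<in> I. s i = \<sigma>}"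
    "\<And>q. (\<lambda>k. r k powr q) sums (\<Sum>i\<in>I. s i powr q)"
    using decreasing_enumeration[of I s] I s by blast
  have "is_singular_value_seq (svd_op I s u v) r"
    unfolding is_singular_value_seq_def using r(1-3) dim_singular_space[OF I u v _ s] by simp
  then have sv: "singular_values (svd_op I s u v) = r"
    by (rule singular_values_eqI)
  show "svd_op I s u v \<in> schatten_class q"
    using compact_operator_svd_op[OF I] r(4)[of q]
    by (auto simp: schatten_class_def sv sums_iff)
  show "schatten_norm q (svd_op I s u v) = (\<Sum>i\<in>I. s i powr q) powr (1 / q)"
    using r(4)[of q] by (simp add: schatten_norm_def sv sums_iff)
qed


section \<open>Finitely supported real matrices\<close>

definition fin_vec :: "nat set \<Rightarrow> (nat \<Rightarrow> real) \<Rightarrow> ell2" where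
  "fin_vec N f = (\<Sum>n\<in>N. scaleC (complex_of_real (f n)) (unit_vec n))"

lemma coord_fin_vec:
  assumes "finite N" "0 \<notin> N"
  shows "coord (fin_vec N f) m = (if m \<in> N then complex_of_real (f m) else 0)"
proof -
  have "coord (fin_vec N f) m = (\<Sum>n\<in>N. if n = m then complex_of_real (f m) else 0)"
    unfolding fin_vec_def coord_sum
    by (rule sum.cong) (use assms in \<open>auto simp: scaleC.rep_eq unit_vec.rep_eq not_le\<close>)
  then show ?thesis
    using assms by simp
qed

lemma cinner_fin_vec:
  assumes "finite N" "0 \<notin> N"
  shows "cinner (fin_vec N f) (fin_vec N g) = complex_of_real (\<Sum>n\<in>N. f n * g n)"
  unfolding fin_vec_def[of N g] cinner_sum_right cinner_scaleC_right cinner_unit_vec_right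
  by (simp add: coord_fin_vec[OF assms] mult.commute)

text \<open>
  A singular value decomposition \<open>M = \<Sum> s\<^sub>i u\<^sub>i v\<^sub>i\<^sup>T\<close> with real orthonormal systems supported in a finite
  index set \<open>N\<close>. Indices may start at \<open>0\<close> (exponents of a prime) as well as at \<open>1\<close> (rows and columns
  of a matrix on \<open>\<ell>\<^sup>2\<close>), and the index set of the decomposition is arbitrary so that tensor products
  can use pairs.
\<close>

definition finite_svd ::
  "inf_matrix \<Rightarrow> nat set \<Rightarrow> 'i set \<Rightarrow> ('i \<Rightarrow> real) \<Rightarrow> ('i \<Rightarrow> nat \<Rightarrow> real) \<Rightarrow> ('i \<Rightarrow> nat \<Rightarrow> real) \<Rightarrow> bool"
where
  "finite_svd M N I s u v \<longleftrightarrow>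
     finite N \<and> finite I \<and> (\<forall>i\<in>I. s i > 0) \<and>
     (\<forall>i\<in>I. \<forall>n. n \<notin> N \<longrightarrow> u i n = 0 \<and> v i n = 0) \<and>
     (\<forall>i\<in>I. \<forall>j\<in>I. (\<Sum>n\<in>N. u i n * u j n) = (if i = j then 1 else 0)) \<and>
     (\<forall>i\<in>I. \<forall>j\<in>I. (\<Sum>n\<in>N. v i n * v j n) = (if i = j then 1 else 0)) \<and>
     (\<forall>m n. M m n = complex_of_real (\<Sum>i\<in>I. s i * u i m * v i n))"

lemma matrix_of_svd_op:
  assumes svd: "finite_svd M N I s u v" and N: "0 \<notin> N"
  shows "matrix_of_op (svd_op I s (\<lambda>i. fin_vec N (u i)) (\<lambda>i. fin_vec N (v i))) = M"
proof (intro ext)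
  fix m n
  have fin: "finite N"
    using svd by (simp add: finite_svd_def)
  have "cinner (unit_vec n) (fin_vec N (v i)) = complex_of_real (v i n)" if "i \<in> I" for i
    using svd that
    by (subst cinner_commute) (simp add: cinner_unit_vec_right coord_fin_vec[OF fin N] finite_svd_def)
  moreover have "coord (fin_vec N (u i)) m = complex_of_real (u i m)" if "i \<in> I" for i
    using svd that by (simp add: coord_fin_vec[OF fin N] finite_svd_def)
  moreover have "M m n = complex_of_real (\<Sum>i\<in>I. s i * u i m * v i n)"
    using svd by (simp add: finite_svd_def)
  ultimately show "matrix_of_op (svd_op I s (\<lambda>i. fin_vec N (u i)) (\<lambda>i. fin_vec N (v i))) m n = M m n"
    by (simp add: matrix_of_op_def cinner_unit_vec_right svd_op_def coord_sum scaleC.rep_eq mult_ac)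
qed

text \<open>
  Only the sum of the \<open>q\<close>-th powers of the singular values matters later. Hiding the decomposition,
  with its index set fixed to be a set of numbers, makes induction over tensor powers possible.
\<close>

definition singular_power_sum :: "real \<Rightarrow> inf_matrix \<Rightarrow> nat set \<Rightarrow> real \<Rightarrow> bool" where
  "singular_power_sum q M N S \<longleftrightarrow>
     (\<exists>(I :: nat set) s u v. finite_svd M N I s u v \<and> S = (\<Sum>i\<in>I. s i powr q))"

lemma schatten_op_of_power_sum:
  assumes "singular_power_sum q M N S" and N: "0 \<notin> N"
  obtains T where "T \<in> schatten_class q" "matrix_of_op T = M"
    "schatten_norm q T = S powr (1 / q)"
proof -
  obtain I :: "nat set" and s u v where svd: "finite_svd M N I s u v"
    and S: "S = (\<Sum>i\<in>I. s i powr q)"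
    using assms by (auto simp: singular_power_sum_def)
  let ?U = "\<lambda>i. fin_vec N (u i)" and ?V = "\<lambda>i. fin_vec N (v i)"
  have fin: "finite N" "finite I" and s: "\<And>i. i \<in> I \<Longrightarrow> s i > 0"
    using svd by (auto simp: finite_svd_def)
  have orth: "orthonormal I ?U" "orthonormal I ?V"
    using svd unfolding orthonormal_def cinner_fin_vec[OF fin(1) N] finite_svd_def by simp_all
  show thesis
    by (rule that[OF schatten_svd_op(1)[OF fin(2) orth s] matrix_of_svd_op[OF svd N]])
      (use schatten_svd_op(2)[OF fin(2) orth s] S in auto)
qed

section \<open>Tensor products along a prime\<close>

definition cofactor :: "nat \<Rightarrow> nat \<Rightarrow> nat" where
  "cofactor p m = m div p ^ multiplicity p m"

text \<open>
  The tensor product of \<open>F\<close> and \<open>M\<close> when \<open>m = p\<^sup>e m'\<close>, with \<open>p\<close> not dividing \<open>m'\<close>, is identified with the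
  pair \<open>(e, m')\<close>: the exponent is an index of \<open>F\<close>, starting at \<open>0\<close>, and the cofactor an index of \<open>M\<close>.
\<close>

definition kron :: "nat \<Rightarrow> inf_matrix \<Rightarrow> inf_matrix \<Rightarrow> inf_matrix" where
  "kron p F M m n = F (multiplicity p m) (multiplicity p n) * M (cofactor p m) (cofactor p n)"

lemma prime_power_cofactor: "p ^ multiplicity p m * cofactor p m = m"
  by (simp add: cofactor_def multiplicity_dvd)

lemma not_dvd_cofactor:
  assumes "prime p" "m > 0"
  shows "\<not> p dvd cofactor p m"
  unfolding cofactor_def
  by (rule multiplicity_decompose) (use assms in \<open>auto simp: not_prime_unit\<close>)

lemma multiplicity_cofactor_times:
  assumes "prime p" "\<not> p dvd n"
  shows "multiplicity p (p ^ e * n) = e" "cofactor p (p ^ e * n) = n"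
proof -
  have n: "n \<noteq> 0" and p: "p \<noteq> 0"
    using assms by (auto intro!: Nat.gr0I)
  show *: "multiplicity p (p ^ e * n) = e"
    using assms n p
    by (subst prime_elem_multiplicity_mult_distrib)
      (auto simp: not_dvd_imp_multiplicity_0 multiplicity_same_power not_prime_unit)
  show "cofactor p (p ^ e * n) = n"
    using p by (simp add: cofactor_def *)
qed

definition kron_support :: "nat \<Rightarrow> nat set \<Rightarrow> nat set \<Rightarrow> nat set" where
  "kron_support p E N = (\<lambda>(e, n). p ^ e * n) ` (E \<times> N)"

lemma mem_kron_support:
  assumes "prime p" "\<And>n. n \<in> N \<Longrightarrow> \<not> p dvd n"
  shows "m \<in> kron_support p E N \<longleftrightarrow> multiplicity p m \<in> E \<and> cofactor p m \<in> N"
proof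
  assume "m \<in> kron_support p E N"
  then show "multiplicity p m \<in> E \<and> cofactor p m \<in> N"
    using assms by (auto simp: kron_support_def multiplicity_cofactor_times)
next
  assume "multiplicity p m \<in> E \<and> cofactor p m \<in> N"
  then show "m \<in> kron_support p E N"
    unfolding kron_support_def
    by (intro image_eqI[of _ _ "(multiplicity p m, cofactor p m)"])
      (auto simp: prime_power_cofactor)
qed

lemma sum_kron_support:
  fixes f g :: "nat \<Rightarrow> real"
  assumes "prime p" "\<And>n. n \<in> N \<Longrightarrow> \<not> p dvd n"
  shows "(\<Sum>m\<in>kron_support p E N. f (multiplicity p m) * g (cofactor p m)) =
    (\<Sum>e\<in>E. f e) * (\<Sum>n\<in>N. g n)"
proof -
  have "inj_on (\<lambda>(e, n). p ^ e * n) (E \<times> N)"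
    by (rule inj_on_inverseI[of _ "\<lambda>m. (multiplicity p m, cofactor p m)"])
      (use assms in \<open>auto simp: multiplicity_cofactor_times\<close>)
  then have "(\<Sum>m\<in>kron_support p E N. f (multiplicity p m) * g (cofactor p m)) =
      (\<Sum>(e, n)\<in>E \<times> N. f e * g n)"
    unfolding kron_support_def
    by (subst sum.reindex) (use assms in \<open>auto simp: multiplicity_cofactor_times intro!: sum.cong\<close>)
  then show ?thesis
    by (simp add: sum_product sum.cartesian_product)
qed

text \<open>
  Tensor products of singular vectors are singular vectors of the tensor product. Their Gram matrix
  is the product of the Gram matrices because the index set is in bijection with \<open>E \<times> N\<close>; this needs
  \<open>N\<close> to avoid multiples of \<open>p\<close>.
\<close>

lemma finite_svd_kron:
  assumes F: "finite_svd F E J s u v" and M: "finite_svd M N I t w z"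
    and p: "prime p" and N: "\<And>n. n \<in> N \<Longrightarrow> \<not> p dvd n"
  shows "finite_svd (kron p F M) (kron_support p E N) (J \<times> I) (\<lambda>(j, i). s j * t i)
    (\<lambda>(j, i) m. u j (multiplicity p m) * w i (cofactor p m))
    (\<lambda>(j, i) m. v j (multiplicity p m) * z i (cofactor p m))"
proof -
  have gram: "(\<Sum>m\<in>kron_support p E N. (x j (multiplicity p m) * y i (cofactor p m)) *
        (x j' (multiplicity p m) * y i' (cofactor p m))) =
      (\<Sum>e\<in>E. x j e * x j' e) * (\<Sum>n\<in>N. y i n * y i' n)"
    for x :: "'a \<Rightarrow> nat \<Rightarrow> real" and y :: "'b \<Rightarrow> nat \<Rightarrow> real" and j j' i i'
    using sum_kron_support[OF p N, where f = "\<lambda>e. x j e * x j' e" and g = "\<lambda>n. y i n * y i' n"]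
    by (simp add: mult_ac)
  have entry: "kron p F M m n = complex_of_real (\<Sum>(j, i)\<in>J \<times> I. s j * t i *
      (u j (multiplicity p m) * w i (cofactor p m)) * (v j (multiplicity p n) * z i (cofactor p n)))"
    for m n
  proof -
    have "F j k = complex_of_real (\<Sum>i\<in>J. s i * u i j * v i k)"
      "M j k = complex_of_real (\<Sum>i\<in>I. t i * w i j * z i k)" for j k
      using F M by (simp_all add: finite_svd_def)
    then show ?thesis
      unfolding kron_def of_real_mult[symmetric] of_real_eq_iff
      by (simp only: of_real_mult[symmetric] of_real_eq_iff sum_product sum.cartesian_product
          split_def mult_ac)
  qed
  show ?thesis
    unfolding finite_svd_def
  proof (intro conjI ballI allI impI)
    show "finite (kron_support p E N)" "finite (J \<times> I)"
      using F M by (auto simp: finite_svd_def kron_support_def)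
    show "kron p F M m n = complex_of_real (\<Sum>x\<in>J \<times> I. (case x of (j, i) \<Rightarrow> s j * t i) *
        (case x of (j, i) \<Rightarrow> \<lambda>m. u j (multiplicity p m) * w i (cofactor p m)) m *
        (case x of (j, i) \<Rightarrow> \<lambda>m. v j (multiplicity p m) * z i (cofactor p m)) n)" for m n
      unfolding entry split_def ..
  next
    fix x assume "x \<in> J \<times> I"
    then obtain j i where x: "x = (j, i)" "j \<in> J" "i \<in> I" by auto
    show "(case x of (j, i) \<Rightarrow> s j * t i) > 0"
      using x F M by (simp add: finite_svd_def)
    fix m assume "m \<notin> kron_support p E N"
    then have "multiplicity p m \<notin> E \<or> cofactor p m \<notin> N"
      using mem_kron_support[OF p N] by blast
    then show "(case x of (j, i) \<Rightarrow> \<lambda>m. u j (multiplicity p m) * w i (cofactor p m)) m = 0"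
      "(case x of (j, i) \<Rightarrow> \<lambda>m. v j (multiplicity p m) * z i (cofactor p m)) m = 0"
      using x F M by (auto simp: finite_svd_def)
  next
    fix x y assume "x \<in> J \<times> I" "y \<in> J \<times> I"
    then obtain j i j' i' where x: "x = (j, i)" "j \<in> J" "i \<in> I" and y: "y = (j', i')" "j' \<in> J" "i' \<in> I"
      by auto
    show "(\<Sum>m\<in>kron_support p E N.
        (case x of (j, i) \<Rightarrow> \<lambda>m. u j (multiplicity p m) * w i (cofactor p m)) m *
        (case y of (j, i) \<Rightarrow> \<lambda>m. u j (multiplicity p m) * w i (cofactor p m)) m) =
        (if x = y then 1 else 0)"
      using x y F M by (simp add: gram finite_svd_def)
    show "(\<Sum>m\<in>kron_support p E N.
        (case x of (j, i) \<Rightarrow> \<lambda>m. v j (multiplicity p m) * z i (cofactor p m)) m *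
        (case y of (j, i) \<Rightarrow> \<lambda>m. v j (multiplicity p m) * z i (cofactor p m)) m) =
        (if x = y then 1 else 0)"
      using x y F M by (simp add: gram finite_svd_def)
  qed
qed

lemma singular_power_sum_kron:
  assumes F: "singular_power_sum q F E S" and M: "singular_power_sum q M N R"
    and p: "prime p" and N: "\<And>n. n \<in> N \<Longrightarrow> \<not> p dvd n"
  shows "singular_power_sum q (kron p F M) (kron_support p E N) (S * R)"
proof -
  obtain J :: "nat set" and s u v where svd1: "finite_svd F E J s u v"
    and S: "S = (\<Sum>j\<in>J. s j powr q)"
    using F by (auto simp: singular_power_sum_def)
  obtain I :: "nat set" and t w z where svd2: "finite_svd M N I t w z"
    and R: "R = (\<Sum>i\<in>I. t i powr q)"
    using M by (auto simp: singular_power_sum_def)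
  obtain s' u' v' where svd: "finite_svd (kron p F M) (kron_support p E N) (J \<times> I) s' u' v'"
    and s': "s' = (\<lambda>(j, i). s j * t i)"
    using finite_svd_kron[OF svd1 svd2 p N] by blast
  \<comment> \<open>Pairs are renamed to numbers to keep the index set in \<^typ>\<open>nat\<close>.\<close>
  have enc: "inj_on prod_encode A" for A
    by (rule inj_prod_encode)
  have "finite_svd (kron p F M) (kron_support p E N) (prod_encode ` (J \<times> I))
      (\<lambda>k. s' (prod_decode k)) (\<lambda>k. u' (prod_decode k)) (\<lambda>k. v' (prod_decode k))"
    using svd unfolding finite_svd_def sum.reindex[OF enc]
    by (auto simp: prod_encode_eq)
  moreover have "S * R = (\<Sum>k\<in>prod_encode ` (J \<times> I). s' (prod_decode k) powr q)"
    unfolding sum.reindex[OF enc] S R s' sum_product sum.cartesian_product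
    using svd1 svd2
    by (intro sum.cong) (auto simp: finite_svd_def powr_mult less_imp_le)
  ultimately show ?thesis
    unfolding singular_power_sum_def by blast
qed

section \<open>Averaging a tensor product\<close>

text \<open>
  The averaging projection onto Hankel matrices, for indices starting at \<open>0\<close>. It is what the Helson
  averaging does to the exponents of a single prime, since \<open>p\<^sup>e\<close> has the \<open>e + 1\<close> divisor pairs
  \<open>(p\<^sup>i, p ^ (e - i))\<close>.
\<close>

definition hankel_averaging :: "inf_matrix \<Rightarrow> inf_matrix" where
  "hankel_averaging F j k = (\<Sum>i\<le>j + k. F i (j + k - i)) / of_nat (j + k + 1)"

definition divisor_pairs :: "nat \<Rightarrow> (nat \<times> nat) set" where
  "divisor_pairs k = {(m, n). m \<ge> 1 \<and> n \<ge> 1 \<and> m * n = k}"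

lemma card_divisor_pairs:
  assumes "k > 0"
  shows "card (divisor_pairs k) = card {d. d dvd k}"
proof (rule bij_betw_same_card)
  show "bij_betw fst (divisor_pairs k) {d. d dvd k}"
    by (rule bij_betw_byWitness[where f' = "\<lambda>d. (d, k div d)"])
      (use assms in \<open>auto simp: divisor_pairs_def Suc_le_eq elim!: dvdE\<close>)
qed

lemma divisor_average_0: "divisor_average a 0 = 0"
  by (simp add: divisor_average_def)

lemma divisor_average_eq:
  assumes "k > 0"
  shows "divisor_average a k = (\<Sum>(m, n)\<in>divisor_pairs k. a m n) / of_nat (card (divisor_pairs k))"
  using assms unfolding divisor_average_def divisor_pairs_def[symmetric]
  by (simp add: card_divisor_pairs)

lemma bij_betw_divisor_pairs:
  assumes p: "prime p" and k: "\<not> p dvd k"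
  shows "bij_betw (\<lambda>(i, m, n). (p ^ i * m, p ^ (e - i) * n))
    ({..e} \<times> divisor_pairs k) (divisor_pairs (p ^ e * k))"
proof (rule bij_betw_byWitness[where
      f' = "\<lambda>(m, n). (multiplicity p m, cofactor p m, cofactor p n)"])
  have p0: "p > 0"
    using p by (rule prime_gt_0_nat)
  have dvd: "\<not> p dvd m" "\<not> p dvd n" if "(m, n) \<in> divisor_pairs k" for m n
    using that k by (auto simp: divisor_pairs_def)
  show "\<forall>x\<in>{..e} \<times> divisor_pairs k.
      (case case x of (i, m, n) \<Rightarrow> (p ^ i * m, p ^ (e - i) * n) of
        (m, n) \<Rightarrow> (multiplicity p m, cofactor p m, cofactor p n)) = x"
    using dvd by (auto simp: multiplicity_cofactor_times[OF p])
  show "(\<lambda>(i, m, n). (p ^ i * m, p ^ (e - i) * n)) ` ({..e} \<times> divisor_pairs k)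
      \<subseteq> divisor_pairs (p ^ e * k)"
    using p0 by (auto simp: divisor_pairs_def Suc_le_eq power_add[symmetric] mult_ac)
  have main: "multiplicity p m + multiplicity p n = e \<and> cofactor p m * cofactor p n = k"
    if "(m, n) \<in> divisor_pairs (p ^ e * k)" for m n
  proof -
    have mn: "m > 0" "n > 0" "m * n = p ^ e * k"
      using that by (auto simp: divisor_pairs_def)
    have "m * n = p ^ (multiplicity p m + multiplicity p n) * (cofactor p m * cofactor p n)"
      using prime_power_cofactor[of p m] prime_power_cofactor[of p n]
      by (metis (no_types, lifting) mult.assoc mult.left_commute power_add)
    then have eq: "p ^ e * k = p ^ (multiplicity p m + multiplicity p n) * (cofactor p m * cofactor p n)"
      using mn by simp
    have nd: "\<not> p dvd cofactor p m * cofactor p n"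
      using not_dvd_cofactor[OF p] mn p by (simp add: prime_dvd_mult_iff)
    show ?thesis
      using multiplicity_cofactor_times[OF p k, of e] multiplicity_cofactor_times[OF p nd]
      unfolding eq by simp
  qed
  show "\<forall>y\<in>divisor_pairs (p ^ e * k).
      (case case y of (m, n) \<Rightarrow> (multiplicity p m, cofactor p m, cofactor p n) of
        (i, m, n) \<Rightarrow> (p ^ i * m, p ^ (e - i) * n)) = y"
  proof clarsimp
    fix m n assume "(m, n) \<in> divisor_pairs (p ^ e * k)"
    then have "e - multiplicity p m = multiplicity p n"
      using main by fastforce
    then show "p ^ multiplicity p m * cofactor p m = m \<and>
        p ^ (e - multiplicity p m) * cofactor p n = n"
      by (simp add: prime_power_cofactor)
  qed
  show "(\<lambda>(m, n). (multiplicity p m, cofactor p m, cofactor p n)) ` divisor_pairs (p ^ e * k)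
      \<subseteq> {..e} \<times> divisor_pairs k"
  proof clarsimp
    fix m n assume mn: "(m, n) \<in> divisor_pairs (p ^ e * k)"
    have "k > 0"
      using k by (auto intro: Nat.gr0I)
    then show "multiplicity p m \<le> e \<and> (cofactor p m, cofactor p n) \<in> divisor_pairs k"
      using main[OF mn] by (auto simp: divisor_pairs_def Suc_le_eq intro: Nat.gr0I)
  qed
qed

text \<open>
  Both the sum over the divisor pairs of \<open>p\<^sup>e k\<close> and their number are products of a factor for \<open>p\<^sup>e\<close> and
  a factor for \<open>k\<close>, so the average factors as well.
\<close>

lemma helson_averaging_kron:
  assumes p: "prime p"
  shows "helson_averaging (kron p F M) = kron p (hankel_averaging F) (helson_averaging M)"
proof (intro ext)
  fix m n
  show "helson_averaging (kron p F M) m n = kron p (hankel_averaging F) (helson_averaging M) m n"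
  \<comment> \<open>At the unused index \<open>0\<close> both sides vanish, as \<open>0\<close> has no divisor pairs.\<close>
  proof (cases "m > 0 \<and> n > 0")
    case False
    then show ?thesis
      by (auto simp: helson_averaging_def kron_def divisor_average_0 cofactor_def)
  next
    case True
    define e where "e = multiplicity p m + multiplicity p n"
    define k where "k = cofactor p m * cofactor p n"
    have mn: "m * n = p ^ e * k"
      using prime_power_cofactor[of p m] prime_power_cofactor[of p n]
      unfolding e_def k_def by (metis (no_types, lifting) mult.assoc mult.left_commute power_add)
    have k: "\<not> p dvd k"
      using not_dvd_cofactor[OF p] True p by (simp add: k_def prime_dvd_mult_iff)
    then have k0: "k > 0"
      by (auto intro: Nat.gr0I)
    have p0: "p > 0"
      using p by (rule prime_gt_0_nat)
    let ?f = "\<lambda>(i, m, n). (p ^ i * m, p ^ (e - i) * n)"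
    have bij: "bij_betw ?f ({..e} \<times> divisor_pairs k) (divisor_pairs (p ^ e * k))"
      by (rule bij_betw_divisor_pairs[OF p k])
    have dvd: "\<not> p dvd m" "\<not> p dvd n" if "(m, n) \<in> divisor_pairs k" for m n
      using that k by (auto simp: divisor_pairs_def)
    have "(\<Sum>(m, n)\<in>divisor_pairs (p ^ e * k). kron p F M m n) =
        (\<Sum>(i, m, n)\<in>{..e} \<times> divisor_pairs k. F i (e - i) * M m n)"
      unfolding sum.reindex_bij_betw[OF bij, symmetric]
      by (rule sum.cong) (use dvd in \<open>auto simp: kron_def multiplicity_cofactor_times[OF p]\<close>)
    also have "\<dots> = (\<Sum>i\<le>e. F i (e - i)) * (\<Sum>(m, n)\<in>divisor_pairs k. M m n)"
      by (simp add: sum_product sum.cartesian_product split_def)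
    finally have sum: "(\<Sum>(m, n)\<in>divisor_pairs (p ^ e * k). kron p F M m n) =
      (\<Sum>i\<le>e. F i (e - i)) * (\<Sum>(m, n)\<in>divisor_pairs k. M m n)" .
    have card: "card (divisor_pairs (p ^ e * k)) = (e + 1) * card (divisor_pairs k)"
      using bij_betw_same_card[OF bij] by (simp add: card_cartesian_product)
    have "divisor_average (kron p F M) (p ^ e * k) =
        (\<Sum>i\<le>e. F i (e - i)) / of_nat (e + 1) * divisor_average M k"
      using k0 p0 by (simp add: divisor_average_eq sum card distrib_right add.commute)
    then show ?thesis
      unfolding helson_averaging_def kron_def hankel_averaging_def mn e_def[symmetric] k_def[symmetric] .
  qed
qed

text \<open>
  The \<open>d\<close>-fold tensor power of \<open>F\<close> on the numbers composed of the primes \<open>p 0, \<dots>, p (d - 1)\<close>. The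
  empty tensor power is the \<open>1 \<times> 1\<close> identity matrix at the index \<open>1\<close>, the empty product of primes.
\<close>

primrec kron_power :: "(nat \<Rightarrow> nat) \<Rightarrow> inf_matrix \<Rightarrow> nat \<Rightarrow> inf_matrix" where
  "kron_power p F 0 = (\<lambda>m n. if m = 1 \<and> n = 1 then 1 else 0)"
| "kron_power p F (Suc d) = kron (p d) F (kron_power p F d)"

lemma helson_averaging_kron_power:
  assumes "\<And>i. prime (p i)"
  shows "helson_averaging (kron_power p F d) = kron_power p (hankel_averaging F) d"
proof (induction d)
  case 0
  have "divisor_average (\<lambda>m n. if m = 1 \<and> n = 1 then 1 else 0) k = (if k = 1 then 1 else 0)"
    for k :: nat
  proof (cases "k = 1")
    case True
    have "divisor_pairs 1 = {(1, 1)}"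
      by (auto simp: divisor_pairs_def)
    then show ?thesis
      using True by (simp add: divisor_average_eq)
  next
    case False
    then have "(\<Sum>(m, n)\<in>divisor_pairs k. if m = 1 \<and> n = 1 then 1 else 0 :: complex) = 0"
      by (intro sum.neutral) (auto simp: divisor_pairs_def)
    then show ?thesis
      using False by (simp add: divisor_average_def divisor_pairs_def)
  qed
  then show ?case
    by (simp add: helson_averaging_def fun_eq_iff)
next
  case (Suc d)
  then show ?case
    by (simp add: helson_averaging_kron[OF assms])
qed

text \<open>
  The support of the \<open>d\<close>-th power consists of products of the first \<open>d\<close> primes of the sequence. Carrying
  the non-divisibility by all later primes through the induction keeps the next tensor factor
  independent of the previous ones.
\<close>

lemma singular_power_sum_kron_power:
  assumes p: "\<And>i. prime (p i)" "inj p" and F: "singular_power_sum q F E S"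
  shows "\<exists>N. (\<forall>n\<in>N. n > 0 \<and> (\<forall>i\<ge>d. \<not> p i dvd n)) \<and>
    singular_power_sum q (kron_power p F d) N (S ^ d)"
proof (induction d)
  case 0
  have "finite_svd (kron_power p F 0) {1} {0 :: nat} (\<lambda>_. 1)
      (\<lambda>_ n. if n = 1 then 1 else 0) (\<lambda>_ n. if n = 1 then 1 else 0)"
    by (auto simp: finite_svd_def)
  then have "singular_power_sum q (kron_power p F 0) {1} (S ^ 0)"
    unfolding singular_power_sum_def by (intro exI conjI) auto
  moreover have "\<forall>n\<in>{1}. n > 0 \<and> (\<forall>i\<ge>0. \<not> p i dvd n)"
    using p(1) not_prime_unit by blast
  ultimately show ?case by blast
next
  case (Suc d)
  then obtain N where N: "\<forall>n\<in>N. n > 0 \<and> (\<forall>i\<ge>d. \<not> p i dvd n)"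
    and M: "singular_power_sum q (kron_power p F d) N (S ^ d)"
    by blast
  have "singular_power_sum q (kron_power p F (Suc d)) (kron_support (p d) E N) (S ^ Suc d)"
    using singular_power_sum_kron[OF F M p(1), of d] N by simp
  moreover have "m > 0 \<and> (\<forall>i\<ge>Suc d. \<not> p i dvd m)" if m: "m \<in> kron_support (p d) E N" for m
  proof -
    obtain e n where n: "n \<in> N" "m = p d ^ e * n"
      using m by (auto simp: kron_support_def)
    have "\<not> p i dvd m" if "i \<ge> Suc d" for i
    proof
      assume "p i dvd m"
      then have "p i dvd p d ^ e \<or> p i dvd n"
        using p(1)[of i] unfolding n(2) by (simp add: prime_dvd_mult_iff)
      moreover have "\<not> p i dvd n"
        using N n(1) that by auto
      ultimately have "p i dvd p d"
        using p(1)[of i] prime_dvd_power by blast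
      then have "p i = p d"
        using p(1) by (simp add: primes_dvd_imp_eq)
      then show False
        using p(2) that by (simp add: inj_eq)
    qed
    moreover have "m > 0"
      using N n p(1)[of d] by (auto simp: prime_gt_0_nat)
    ultimately show ?thesis by blast
  qed
  ultimately show ?case by blast
qed

text \<open>
  On \<open>d\<close>-th tensor powers the projection enlarges the norm by exactly \<open>\<rho>\<^sup>d\<close> with
  \<open>\<rho> = (B / A) powr (1 / q) > 1\<close>, which exceeds every constant.
\<close>

lemma unbounded_by_tensor_powers:
  assumes F: "singular_power_sum q F E A"
    and H: "singular_power_sum q (hankel_averaging F) E' B"
    and AB: "0 < A" "A < B" and q: "q > 0"
  shows "\<not> bounded_on_schatten q helson_averaging"
proof
  assume "bounded_on_schatten q helson_averaging"
  then obtain C where C: "\<And>T. T \<in> schatten_class q \<Longrightarrow> \<exists>R\<in>schatten_class q.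
      defines_op (helson_averaging (matrix_of_op T)) R \<and> schatten_norm q R \<le> C * schatten_norm q T"
    unfolding bounded_on_schatten_def by blast
  define p where "p = enumerate {p :: nat. prime p}"
  have p: "\<And>i. prime (p i)" "inj p"
    using enumerate_in_set[OF primes_infinite]
      strict_mono_imp_inj_on[OF strict_mono_enumerate[OF primes_infinite]]
    by (auto simp: p_def)
  define \<rho> where "\<rho> = (B / A) powr (1 / q)"
  have "\<rho> > 1"
    using AB q by (simp add: \<rho>_def)
  have "\<rho> ^ d \<le> C" for d
  proof -
    obtain N where N: "0 \<notin> N" "singular_power_sum q (kron_power p F d) N (A ^ d)"
      using singular_power_sum_kron_power[OF p F, of d] by blast
    obtain N' where N': "0 \<notin> N'"
      "singular_power_sum q (kron_power p (hankel_averaging F) d) N' (B ^ d)"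
      using singular_power_sum_kron_power[OF p H, of d] by blast
    obtain T where T: "T \<in> schatten_class q" "matrix_of_op T = kron_power p F d"
      "schatten_norm q T = (A ^ d) powr (1 / q)"
      using schatten_op_of_power_sum[OF N(2,1)] .
    obtain T' where T': "T' \<in> schatten_class q"
      "matrix_of_op T' = kron_power p (hankel_averaging F) d"
      "schatten_norm q T' = (B ^ d) powr (1 / q)"
      using schatten_op_of_power_sum[OF N'(2,1)] .
    obtain R where R: "R \<in> schatten_class q"
      "defines_op (helson_averaging (matrix_of_op T)) R"
      "schatten_norm q R \<le> C * schatten_norm q T"
      using C[OF T(1)] by blast
    \<comment> \<open>The norm of \<open>R\<close> is accessible because \<open>R\<close> has the matrix of the explicit operator \<open>T'\<close>.\<close>
    have "R = T'"
      using R(1,2) T'(1,2)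
      by (intro compact_operator_eqI)
        (auto simp: schatten_class_def defines_op_def T(2) helson_averaging_kron_power[OF p(1)])
    then have "(B ^ d) powr (1 / q) \<le> C * (A ^ d) powr (1 / q)"
      using R(3) T(3) T'(3) by simp
    then have "(B ^ d) powr (1 / q) / (A ^ d) powr (1 / q) \<le> C"
      using AB by (simp add: field_simps)
    also have "(B ^ d) powr (1 / q) / (A ^ d) powr (1 / q) = \<rho> ^ d"
      using AB by (simp add: \<rho>_def powr_divide[symmetric] power_divide[symmetric]
          powr_realpow[symmetric] powr_powr mult.commute)
    finally show ?thesis .
  qed
  then show False
    using real_arch_pow[OF \<open>\<rho> > 1\<close>, of C] by (meson not_le)
qed

section \<open>Three small matrices\<close>

definition hankel_example :: "real \<Rightarrow> inf_matrix" where
  "hankel_example a j k = (if j + k = 0 then of_real a else if j + k = 2 then 1 else 0)"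

definition row_example :: "real \<Rightarrow> inf_matrix" where
  "row_example a j k =
     (if j = 0 \<and> k = 0 then of_real a else if j = 0 \<and> k = 2 then 3 else 0)"

definition diagonal_example :: "real \<Rightarrow> inf_matrix" where
  "diagonal_example a j k =
     (if j = 0 \<and> k = 0 then of_real a else if j = 1 \<and> k = 1 then 3 else 0)"

lemma hankel_averaging_eq_hankel_example:
  assumes "F 0 0 = of_real a" "F 0 2 + F 1 1 + F 2 0 = 3"
    and "\<And>j k. j + k \<noteq> 0 \<Longrightarrow> j + k \<noteq> 2 \<Longrightarrow> F j k = 0"
  shows "hankel_averaging F = hankel_example a"
proof (intro ext)
  fix j k
  show "hankel_averaging F j k = hankel_example a j k"
  proof (cases "j + k = 0 \<or> j + k = 2")
    case True
    have "(\<Sum>i\<le>2. F i (2 - i)) = 3"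
      using assms(2) by (simp add: eval_nat_numeral)
    then show ?thesis
      using True assms(1)
      by (elim disjE) (simp_all only: hankel_averaging_def hankel_example_def, simp_all)
  next
    case False
    then have "(\<Sum>i\<le>j + k. F i (j + k - i)) = 0"
      by (intro sum.neutral ballI assms(3)) auto
    then show ?thesis
      using False unfolding hankel_averaging_def hankel_example_def by (simp only: if_False div_0 de_Morgan_disj)
  qed
qed

lemma hankel_averaging_row: "hankel_averaging (row_example a) = hankel_example a"
  by (rule hankel_averaging_eq_hankel_example) (auto simp: row_example_def)

lemma hankel_averaging_diagonal: "hankel_averaging (diagonal_example a) = hankel_example a"
  by (rule hankel_averaging_eq_hankel_example) (auto simp: diagonal_example_def)

lemma power_sum_row_example:
  "singular_power_sum q (row_example a) {0, 1, 2} (sqrt (a\<^sup>2 + 9) powr q)"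
proof -
  define r where "r = sqrt (a\<^sup>2 + 9)"
  have r: "r > 0" "r\<^sup>2 = a\<^sup>2 + 9"
    by (auto simp: r_def add_nonneg_pos)
  have "a * a + 9 \<noteq> 0"
    using mult_pos_pos[OF r(1) r(1)] r(2) by (simp add: power2_eq_square)
  then have "a * a / (a * a + 9) + 9 / (a * a + 9) = 1"
    by (simp add: add_divide_distrib[symmetric])
  then have "finite_svd (row_example a) {0, 1, 2} {0 :: nat} (\<lambda>_. r)
      (\<lambda>_ n. if n = 0 then 1 else 0)
      (\<lambda>_ n. if n = 0 then a / r else if n = 2 then 3 / r else 0)"
    using r by (auto simp: finite_svd_def row_example_def field_simps power2_eq_square)
  then show ?thesis
    unfolding singular_power_sum_def r_def by (intro exI conjI) auto
qed

lemma power_sum_diagonal_example: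
  assumes "a > 0"
  shows "singular_power_sum q (diagonal_example a) {0, 1, 2} (a powr q + 3 powr q)"
proof -
  have "finite_svd (diagonal_example a) {0, 1, 2} {0, 1 :: nat} (\<lambda>i. if i = 0 then a else 3)
      (\<lambda>i n. if n = i then 1 else 0) (\<lambda>i n. if n = i then 1 else 0)"
    using assms by (auto simp: finite_svd_def diagonal_example_def)
  then show ?thesis
    unfolding singular_power_sum_def by (intro exI conjI) auto
qed

text \<open>
  On the coordinates \<open>0, 2\<close> the matrix has trace \<open>t - 1/t\<close> and determinant \<open>-1\<close>, hence eigenvalues \<open>t\<close> and
  \<open>-1/t\<close>, with eigenvectors \<open>(t, 1)\<close> and \<open>(1, -t)\<close>; the coordinate \<open>1\<close> carries the eigenvalue \<open>1\<close>.
\<close>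

lemma power_sum_hankel_example:
  assumes t: "t > 0"
  shows "singular_power_sum q (hankel_example (t - 1 / t)) {0, 1, 2}
    (t powr q + 1 + (1 / t) powr q)"
proof -
  define c where "c = 1 / sqrt (1 + t\<^sup>2)"
  have t2: "1 + t * t > 0"
    by (simp add: add_pos_nonneg)
  then have c: "c * c = 1 / (1 + t * t)"
    by (simp add: c_def power2_eq_square)
  define s where "s i = (if i = 0 then t else if i = 1 then 1 else 1 / t)" for i :: nat
  define v where "v i n =
    (if i = 0 then if n = 0 then t * c else if n = 2 then c else 0
     else if i = 1 then if n = 1 then 1 else 0
     else if n = 0 then c else if n = 2 then - t * c else 0)" for i n :: nat
  \<comment> \<open>The sign of the negative eigenvalue is moved into the left singular vector.\<close>
  define u where "u i n = (if i = 2 then - v i n else v i n)" for i n :: nat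
  have sum1: "c * c + t * c * (t * c) = 1"
  proof -
    have "c * c + t * c * (t * c) = (1 + t * t) * (c * c)"
      by (simp add: algebra_simps)
    then show ?thesis
      using t2 by (simp add: c)
  qed
  have e00: "t * (t * c) * (t * c) - 1 / t * c * c = t - 1 / t"
  proof -
    have "t * (t * c) * (t * c) - 1 / t * c * c = (t - 1 / t) * (c * c + t * c * (t * c))"
      using t by (simp add: field_simps)
    then show ?thesis
      by (simp add: sum1)
  qed
  have entry: "(\<Sum>i\<in>{0, 1, 2}. s i * u i m * v i n) =
      (if m + n = 0 then t - 1 / t else if m + n = 2 then 1 else 0)" for m n
  proof (cases "m \<in> {0, 1, 2} \<and> n \<in> {0, 1, 2}")
    case True
    then show ?thesis
      using t sum1 e00 by (auto simp: s_def u_def v_def mult_ac)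
  next
    case False
    then show ?thesis
      by (auto simp: u_def v_def)
  qed
  have "finite_svd (hankel_example (t - 1 / t)) {0, 1, 2} {0, 1, 2} s u v"
    unfolding finite_svd_def
  proof (intro conjI allI ballI)
    fix m n
    show "hankel_example (t - 1 / t) m n = complex_of_real (\<Sum>i\<in>{0, 1, 2}. s i * u i m * v i n)"
      unfolding entry hankel_example_def by simp
  qed (use t sum1 in \<open>auto simp: s_def u_def v_def mult_ac add.commute\<close>)
  then show ?thesis
    unfolding singular_power_sum_def by (intro exI conjI) (auto simp: s_def)
qed

text \<open>
  Since \<open>(t - 1/t)\<^sup>2 + 9 \<le> t\<^sup>2 (1 + 8/t\<^sup>2)\<close> and \<open>q/2 \<le> 1\<close>, the left side is at most
  \<open>t\<^sup>q (1 + 8/t\<^sup>2) = t\<^sup>q + 8 t ^ (q - 2)\<close>. The choice of \<open>t\<close> makes the last term equal to \<open>1\<close>.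
\<close>

lemma row_parameter:
  assumes "0 < q" "q < 2"
  obtains t :: real where "t > 1"
    "sqrt ((t - 1 / t)\<^sup>2 + 9) powr q < t powr q + 1 + (1 / t) powr q"
proof -
  define t :: real where "t = 8 powr (1 / (2 - q))"
  have t: "t > 1"
    using assms by (simp add: t_def)
  have t8: "t powr (2 - q) = 8"
    using assms by (simp add: t_def powr_powr)
  have "(t - 1 / t)\<^sup>2 + 9 \<le> t\<^sup>2 * (1 + 8 / t\<^sup>2)"
  proof -
    have "(1 / t)\<^sup>2 \<le> 1"
      using t by (intro power_le_one) auto
    moreover have "(t - 1 / t)\<^sup>2 = t\<^sup>2 - 2 + (1 / t)\<^sup>2" "t\<^sup>2 * (1 + 8 / t\<^sup>2) = t\<^sup>2 + 8"
      using t by (simp_all add: power2_diff distrib_left)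
    ultimately show ?thesis
      by linarith
  qed
  then have "sqrt ((t - 1 / t)\<^sup>2 + 9) \<le> t * sqrt (1 + 8 / t\<^sup>2)"
    using t by (metis abs_of_pos less_trans real_sqrt_abs real_sqrt_le_iff real_sqrt_mult zero_less_one)
  then have "sqrt ((t - 1 / t)\<^sup>2 + 9) powr q \<le> (t * sqrt (1 + 8 / t\<^sup>2)) powr q"
    using assms by (intro powr_mono2) auto
  also have "\<dots> = t powr q * (1 + 8 / t\<^sup>2) powr (q / 2)"
    using t by (simp add: powr_mult powr_half_sqrt[symmetric] powr_powr)
  also have "\<dots> \<le> t powr q * (1 + 8 / t\<^sup>2) powr 1"
    using assms t by (intro mult_left_mono powr_mono) auto
  also have "\<dots> = t powr q + 8 * (t powr q / t powr 2)"
    using t by (simp add: algebra_simps powr_numeral)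
  also have "t powr q / t powr 2 = 1 / t powr (2 - q)"
    using t by (simp add: powr_diff)
  also have "t powr q + 8 * (1 / t powr (2 - q)) < t powr q + 1 + (1 / t) powr q"
    using t by (simp add: t8)
  finally show thesis
    using that t by blast
qed

text \<open>
  Since \<open>q \<ge> 1\<close>, \<open>(t - 1/t)\<^sup>q = t\<^sup>q (1 - 1/t\<^sup>2)\<^sup>q \<le> t\<^sup>q - t ^ (q - 2)\<close>. The choice of \<open>t\<close> makes the
  subtracted term equal to \<open>3\<^sup>q\<close>.
\<close>

lemma diagonal_parameter:
  assumes "2 < q"
  obtains t :: real where "t > 1"
    "(t - 1 / t) powr q + 3 powr q < t powr q + 1 + (1 / t) powr q"
proof -
  define t :: real where "t = 3 powr (q / (q - 2))"
  have t: "t > 1"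
    using assms by (simp add: t_def)
  have t3: "t powr (q - 2) = 3 powr q"
    using assms by (simp add: t_def powr_powr)
  have t1: "1 / t\<^sup>2 < 1"
    using t by (simp add: power2_eq_square less_1_mult)
  have inv: "(1 / t) powr q > 0"
    using t by simp
  have "(t - 1 / t) powr q = (t * (1 - 1 / t\<^sup>2)) powr q"
    using t by (simp add: right_diff_distrib power2_eq_square)
  also have "\<dots> = t powr q * (1 - 1 / t\<^sup>2) powr q"
    using t t1 by (simp add: powr_mult)
  also have "\<dots> \<le> t powr q * (1 - 1 / t\<^sup>2) powr 1"
    using t t1 assms by (intro mult_left_mono powr_mono') auto
  also have "\<dots> = t powr q - t powr (q - 2)"
    using t t1 by (simp add: algebra_simps powr_diff powr_numeral)
  finally have "(t - 1 / t) powr q + 3 powr q < t powr q + 1 + (1 / t) powr q"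
    unfolding t3 using inv by linarith
  then show thesis
    using that t by blast
qed

theorem theorem1:
  fixes q :: real
  assumes "1 \<le> q" and "q \<noteq> 2"
  shows "\<not> bounded_on_schatten q helson_averaging"
proof (cases "q < 2")
  case True
  then obtain t :: real where t: "t > 1"
    and less: "sqrt ((t - 1 / t)\<^sup>2 + 9) powr q < t powr q + 1 + (1 / t) powr q"
    using row_parameter[of q] assms by auto
  have "sqrt ((t - 1 / t)\<^sup>2 + 9) > 0"
    by (simp add: add_nonneg_pos)
  then show ?thesis
    using t less assms
    by (intro unbounded_by_tensor_powers[OF power_sum_row_example _ _ less])
      (auto simp: hankel_averaging_row intro!: power_sum_hankel_example)
next
  case False
  then obtain t :: real where t: "t > 1"
    and less: "(t - 1 / t) powr q + 3 powr q < t powr q + 1 + (1 / t) powr q"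
    using diagonal_parameter[of q] assms by auto
  have a: "t - 1 / t > 0"
    using t by (simp add: field_simps less_1_mult)
  then show ?thesis
    using t less assms
    by (intro unbounded_by_tensor_powers[OF power_sum_diagonal_example[OF a] _ _ less])
      (auto simp: hankel_averaging_diagonal add_pos_pos intro!: power_sum_hankel_example)
qed

end
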